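(* Let $\mathscr{H}$ be a complex Hilbert space and let $B,C$ be bounded linear operators on $\mathscr{H}$. Then $$\max_{0\leq\alpha\leq1}w\left(\alpha B^2+(1-\alpha)C^2\right) \;\leq\; w_e^2(B,C),$$ where the maximum is over real $\alpha\in[0,1]$.
   Context: For a bounded linear operator $A$ on a complex Hilbert space $\mathscr{H}$ with inner product $\langle\cdot,\cdot\rangle$, the numerical radius is $w(A)=\sup\{|\langle Ax,x\rangle| : x\in\mathscr{H}, \|x\|=1\}$. The Euclidean operator radius of a pair of bounded linear operators $B,C$ is $w_e(B,C)=\sup\{\sqrt{|\langle Bx,x\rangle|^2+|\langle Cx,x\rangle|^2} : x\in\mathscr{H}, \|x\|=1\}$, and $w_e^2(B,C)$ denotes $(w_e(B,C))^2$. *)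

theory Defs
  imports "HOL-Analysis.Analysis"
begin

class complex_vector = real_vector +
  fixes scaleC :: "complex \<Rightarrow> 'a \<Rightarrow> 'a" (infixr "*\<^sub>C" 75)
  assumes scaleC_add_right: "a *\<^sub>C (x + y) = a *\<^sub>C x + a *\<^sub>C y"
    and scaleC_add_left: "(a + b) *\<^sub>C x = a *\<^sub>C x + b *\<^sub>C x"
    and scaleC_scaleC: "a *\<^sub>C (b *\<^sub>C x) = (a * b) *\<^sub>C x"
    and scaleC_one: "1 *\<^sub>C x = x"
    and scaleC_of_real: "complex_of_real r *\<^sub>C x = r *\<^sub>R x"

text \<open>The inner product is linear in the first argument and conjugate-linear in the second.\<close>

class complex_inner = complex_vector + real_normed_vector +
  fixes cinner :: "'a \<Rightarrow> 'a \<Rightarrow> complex"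
  assumes cinner_commute: "cinner x y = cnj (cinner y x)"
    and cinner_add_left: "cinner (x + y) z = cinner x z + cinner y z"
    and cinner_scaleC_left: "cinner (c *\<^sub>C x) y = c * cinner x y"
    and cinner_ge_zero: "0 \<le> Re (cinner x x)"
    and cinner_eq_zero_iff: "cinner x x = 0 \<longleftrightarrow> x = 0"
    and norm_eq_sqrt_cinner: "norm x = sqrt (Re (cinner x x))"

class chilbert_space = complex_inner + complete_space

subclass (in chilbert_space) banach ..

instantiation complex :: chilbert_space
begin

definition scaleC_complex :: "complex \<Rightarrow> complex \<Rightarrow> complex"
  where "scaleC_complex c z = c * z"

definition cinner_complex :: "complex \<Rightarrow> complex \<Rightarrow> complex"
  where "cinner_complex z w = z * cnj w"

instance
  by standard
    (auto simp: scaleC_complex_def cinner_complex_def algebra_simps scaleR_conv_of_real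
      cmod_def power2_eq_square)

end

definition bounded_clinear :: "('a::complex_inner \<Rightarrow> 'b::complex_inner) \<Rightarrow> bool"
  where "bounded_clinear A \<longleftrightarrow> bounded_linear A \<and> (\<forall>c x. A (c *\<^sub>C x) = c *\<^sub>C A x)"

text \<open>
  The two suprema are suprema of sets of nonnegative reals, taken in \<open>[0, \<infinity>)\<close>. Inserting \<open>0\<close>
  only matters for the zero space, which has no unit vectors and where \<^term>\<open>Sup {} :: real\<close>
  would be an unspecified number.
\<close>

definition numerical_radius :: "('a::complex_inner \<Rightarrow> 'a) \<Rightarrow> real"
  where "numerical_radius A = Sup (insert 0 {cmod (cinner (A x) x) | x. norm x = 1})"

definition euclidean_operator_radius ::
    "('a::complex_inner \<Rightarrow> 'a) \<Rightarrow> ('a \<Rightarrow> 'a) \<Rightarrow> real"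
  where "euclidean_operator_radius B C =
    Sup (insert 0 {sqrt ((cmod (cinner (B x) x))\<^sup>2 + (cmod (cinner (C x) x))\<^sup>2) | x. norm x = 1})"

end

theory Submission imports Defs begin

text \<open>
  The map \<open>\<alpha> \<mapsto> w(\<alpha>B\<^sup>2 + (1 - \<alpha>)C\<^sup>2)\<close> is convex, so its maximum over \<open>[0, 1]\<close> is attained at an
  endpoint, and it suffices to bound \<open>w(B\<^sup>2)\<close> and \<open>w(C\<^sup>2)\<close>. As \<open>w(B), w(C) \<le> w\<^sub>e(B, C)\<close>, this is the
  power inequality \<open>w(A\<^sup>2) \<le> w(A)\<^sup>2\<close>, which follows from Pearcy's identity: for
  \<open>u = kx + Tx\<close> and \<open>v = kx - Tx\<close>,
  \<open>\<langle>ku - Tu, u\<rangle> + \<langle>kv + Tv, v\<rangle> = 2k\<langle>k\<^sup>2x - T\<^sup>2x, x\<rangle>\<close>,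
  where \<open>T\<close> is \<open>A\<close> rotated so that \<open>\<langle>T\<^sup>2x, x\<rangle> = |\<langle>A\<^sup>2x, x\<rangle>|\<close>.
\<close>

section \<open>Inner product identities and the Cauchy-Schwarz inequality\<close>

lemma cinner_add_right: "cinner x (y + z) = cinner x y + cinner x z"
  for x y z :: "'a::complex_inner"
  by (metis cinner_add_left cinner_commute complex_cnj_add)

lemma cinner_scaleC_right: "cinner x (c *\<^sub>C y) = cnj c * cinner x y"
  for x y :: "'a::complex_inner"
  by (metis cinner_scaleC_left cinner_commute complex_cnj_mult)

lemma cinner_scaleR_left: "cinner (r *\<^sub>R x) y = complex_of_real r * cinner x y"
  for x y :: "'a::complex_inner"
  by (metis cinner_scaleC_left scaleC_of_real)

lemma cinner_scaleR_right: "cinner x (r *\<^sub>R y) = complex_of_real r * cinner x y"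
  for x y :: "'a::complex_inner"
  by (metis cinner_scaleC_right scaleC_of_real complex_cnj_complex_of_real)

lemma cinner_diff_left: "cinner (x - y) z = cinner x z - cinner y z"
  for x y z :: "'a::complex_inner"
  using cinner_add_left[of "x - y" y z] by simp

lemma cinner_self: "cinner x x = complex_of_real ((norm x)\<^sup>2)"
  for x :: "'a::complex_inner"
proof -
  have "Im (cinner x x) = 0"
    using cinner_commute[of x x] by (simp add: complex_eq_iff)
  moreover have "Re (cinner x x) = (norm x)\<^sup>2"
    by (simp add: norm_eq_sqrt_cinner cinner_ge_zero)
  ultimately show ?thesis by (simp add: complex_eq_iff)
qed

lemma norm_scaleC: "norm (c *\<^sub>C x) = cmod c * norm x"
  for x :: "'a::complex_inner"
proof -
  have "complex_of_real ((norm (c *\<^sub>C x))\<^sup>2) = c * cnj c * cinner x x"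
    by (simp only: cinner_self[symmetric] cinner_scaleC_left cinner_scaleC_right mult_ac)
  also have "\<dots> = complex_of_real ((cmod c * norm x)\<^sup>2)"
    by (simp add: cinner_self power_mult_distrib flip: complex_norm_square)
  finally have "(norm (c *\<^sub>C x))\<^sup>2 = (cmod c * norm x)\<^sup>2"
    by (simp only: of_real_eq_iff)
  then show ?thesis by (simp add: power2_eq_iff_nonneg)
qed

text \<open>Used to replace the modulus of an inner product by the inner product itself after a
  unimodular rescaling. The factor is \<open>cnj z / cmod z\<close>, or 1 when \<open>z\<close>
  vanishes.\<close>

lemma unit_rotation:
  obtains c :: complex where "cmod c = 1" "c * z = complex_of_real (cmod z)"
proof (cases "z = 0")
  case True
  then show ?thesis using that[of 1] by simp
next
  case False
  have "cnj z * z = complex_of_real (cmod z) * complex_of_real (cmod z)"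
    using complex_norm_square[of z] by (simp add: power2_eq_square mult.commute)
  then show ?thesis
    using False that[of "cnj z / complex_of_real (cmod z)"]
    by (simp add: norm_divide)
qed

text \<open>The class assumes the triangle inequality, so Cauchy--Schwarz follows by polarization.\<close>

lemma cinner_Cauchy_Schwarz: "cmod (cinner x y) \<le> norm x * norm y"
  for x y :: "'a::complex_inner"
proof -
  obtain c where c: "cmod c = 1" "c * cinner x y = complex_of_real (cmod (cinner x y))"
    by (rule unit_rotation)
  \<comment> \<open>After this rotation both cross terms of the squared norm of
    \<open>?u + y\<close> equal the modulus of \<open>cinner x y\<close>; squaring the triangle
    inequality then bounds their sum.\<close>
  let ?u = "c *\<^sub>C x"
  have uy: "cinner ?u y = complex_of_real (cmod (cinner x y))"
    by (simp add: cinner_scaleC_left c)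
  have yu: "cinner y ?u = complex_of_real (cmod (cinner x y))"
    by (metis uy cinner_commute complex_cnj_complex_of_real)
  have "complex_of_real ((norm (?u + y))\<^sup>2)
      = complex_of_real ((norm ?u)\<^sup>2 + (norm y)\<^sup>2 + 2 * cmod (cinner x y))"
    by (simp only: cinner_self[symmetric] cinner_add_left cinner_add_right uy yu of_real_add) simp
  then have "(norm (?u + y))\<^sup>2 = (norm x)\<^sup>2 + (norm y)\<^sup>2 + 2 * cmod (cinner x y)"
    by (simp only: of_real_eq_iff norm_scaleC c mult_1)
  moreover have "(norm (?u + y))\<^sup>2 \<le> (norm x + norm y)\<^sup>2"
    using norm_triangle_ineq[of ?u y] by (simp add: norm_scaleC c power_mono)
  ultimately show ?thesis by (simp add: power2_sum)
qed

section \<open>Basic estimates for the numerical radius\<close>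

lemma bounded_linear_cinner_bound:
  fixes A :: "'a::complex_inner \<Rightarrow> 'a"
  assumes "bounded_linear A"
  obtains K where "\<And>x. norm x = 1 \<Longrightarrow> cmod (cinner (A x) x) \<le> K"
proof -
  obtain K where K: "\<And>x. norm (A x) \<le> norm x * K"
    using bounded_linear.bounded[OF assms] by blast
  show ?thesis
  proof
    fix x :: 'a assume "norm x = 1"
    then show "cmod (cinner (A x) x) \<le> K"
      using cinner_Cauchy_Schwarz[of "A x" x] K[of x] by simp
  qed
qed

lemma cinner_le_numerical_radius:
  fixes A :: "'a::complex_inner \<Rightarrow> 'a"
  assumes "bounded_linear A" "norm x = 1"
  shows "cmod (cinner (A x) x) \<le> numerical_radius A"
proof -
  obtain K where "\<And>x. norm x = 1 \<Longrightarrow> cmod (cinner (A x) x) \<le> K"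
    using bounded_linear_cinner_bound[OF assms(1)] by blast
  \<comment> \<open>A real \<open>Sup\<close> dominates its set only once the set is known to be
    bounded above.\<close>
  then have "bdd_above {cmod (cinner (A x) x) | x. norm x = 1}"
    by (auto intro!: bdd_aboveI)
  then show ?thesis
    unfolding numerical_radius_def using assms(2) by (intro cSup_upper) auto
qed

text \<open>Nonnegativity of \<open>K\<close> accounts for the 0 inserted into the set.\<close>

lemma numerical_radius_le:
  fixes A :: "'a::complex_inner \<Rightarrow> 'a"
  assumes "0 \<le> K" "\<And>x. norm x = 1 \<Longrightarrow> cmod (cinner (A x) x) \<le> K"
  shows "numerical_radius A \<le> K"
  unfolding numerical_radius_def using assms by (intro cSup_least) auto

lemma numerical_radius_nonneg:
  fixes A :: "'a::complex_inner \<Rightarrow> 'a"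
  assumes "bounded_linear A"
  shows "0 \<le> numerical_radius A"
proof -
  obtain K where "\<And>x. norm x = 1 \<Longrightarrow> cmod (cinner (A x) x) \<le> K"
    using bounded_linear_cinner_bound[OF assms] by blast
  then have "bdd_above {cmod (cinner (A x) x) | x. norm x = 1}"
    by (auto intro!: bdd_aboveI)
  then show ?thesis
    unfolding numerical_radius_def by (intro cSup_upper) auto
qed

lemma numerical_radius_convex:
  fixes A D :: "'a::complex_inner \<Rightarrow> 'a"
  assumes "bounded_linear A" "bounded_linear D" "0 \<le> s" "0 \<le> t"
  shows "numerical_radius (\<lambda>x. s *\<^sub>R A x + t *\<^sub>R D x)
    \<le> s * numerical_radius A + t * numerical_radius D"
proof (rule numerical_radius_le)
  show "0 \<le> s * numerical_radius A + t * numerical_radius D"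
    using assms by (simp add: numerical_radius_nonneg)
next
  fix x :: 'a assume x: "norm x = 1"
  have "cmod (cinner (s *\<^sub>R A x + t *\<^sub>R D x) x)
      \<le> s * cmod (cinner (A x) x) + t * cmod (cinner (D x) x)"
    using norm_triangle_ineq[of "s * cinner (A x) x" "t * cinner (D x) x"] assms(3,4)
    by (simp add: cinner_add_left cinner_scaleR_left norm_mult)
  also have "\<dots> \<le> s * numerical_radius A + t * numerical_radius D"
    using assms x by (intro add_mono mult_left_mono cinner_le_numerical_radius) auto
  finally show "cmod (cinner (s *\<^sub>R A x + t *\<^sub>R D x) x)
      \<le> s * numerical_radius A + t * numerical_radius D" .
qed

section \<open>The power inequality for squares\<close>

text \<open>The quadratic form is homogeneous of degree 2. This extension beyond unit vectors is
  what allows the bound to be applied to the unnormalised \<open>u\<close> and \<open>v\<close> of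
  Pearcy's identity.\<close>

lemma cinner_bound_scale:
  fixes A :: "'a::complex_inner \<Rightarrow> 'a"
  assumes "bounded_linear A" "\<And>x. norm x = 1 \<Longrightarrow> cmod (cinner (A x) x) \<le> K"
  shows "cmod (cinner (A y) y) \<le> K * (norm y)\<^sup>2"
proof (cases "y = 0")
  case True
  then show ?thesis
    using cinner_Cauchy_Schwarz[of "A y" y] by simp
next
  case False
  let ?u = "y /\<^sub>R norm y"
  have "A y = norm y *\<^sub>R A ?u"
    using False linear_scale[OF bounded_linear.linear[OF assms(1)], of "norm y" ?u] by simp
  moreover have "y = norm y *\<^sub>R ?u" using False by simp
  ultimately have "cinner (A y) y = norm y * (norm y * cinner (A ?u) ?u)"
    by (metis cinner_scaleR_left cinner_scaleR_right)
  then have "cmod (cinner (A y) y) = (norm y)\<^sup>2 * cmod (cinner (A ?u) ?u)"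
    by (simp add: norm_mult power2_eq_square)
  also have "\<dots> \<le> (norm y)\<^sup>2 * K"
    using False by (intro mult_left_mono assms(2)) auto
  finally show ?thesis by (simp add: mult.commute)
qed

text \<open>The bound, applied at \<open>u\<close> and \<open>v\<close>, makes both terms on the
  left of Pearcy's identity have nonnegative real part. Cancelling the positive factor
  \<open>2 * k\<close> on the right leaves the claim.\<close>

lemma cinner_square_bound:
  fixes A :: "'a::complex_inner \<Rightarrow> 'a"
  assumes A: "bounded_clinear A" and k: "0 < k"
    and bound: "\<And>y. cmod (cinner (A y) y) \<le> k * (norm y)\<^sup>2"
  shows "cmod (cinner (A (A x)) x) \<le> k\<^sup>2 * (norm x)\<^sup>2"
proof -
  obtain d where d: "cmod d = 1"
    "d * cinner (A (A x)) x = complex_of_real (cmod (cinner (A (A x)) x))"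
    by (rule unit_rotation)
  \<comment> \<open>Since \<open>T\<close> enters the identity squared, \<open>A\<close> is
    multiplied by a square root of the desired rotation \<open>d\<close>. It is unimodular too, so
    \<open>T\<close> inherits the bound on \<open>A\<close>.\<close>
  define c where "c = csqrt d"
  have c: "cmod c = 1" "c * c = d"
    using d(1) by (simp_all add: c_def flip: power2_eq_square)
  define T where "T = (\<lambda>y. c *\<^sub>C A y)"
  have lin: "linear A" and scC: "\<And>a y. A (a *\<^sub>C y) = a *\<^sub>C A y"
    using A by (auto simp: bounded_clinear_def bounded_linear.linear)
  have T_add: "T (y + z) = T y + T z" for y z
    by (simp add: T_def linear_add[OF lin] scaleC_add_right)
  have T_scale: "T (r *\<^sub>R y) = r *\<^sub>R T y" for r y
    unfolding T_def scaleC_of_real[symmetric] scC scaleC_scaleC by (simp add: mult.commute)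
  have T_diff: "T (y - z) = T y - T z" for y z
    using T_add[of "y - z" z] by (simp add: algebra_simps)
  have TT: "T (T y) = d *\<^sub>C A (A y)" for y
    by (simp add: T_def scC scaleC_scaleC c)
  have T_bound: "\<bar>Re (cinner (T y) y)\<bar> \<le> k * (norm y)\<^sup>2" for y
    using abs_Re_le_cmod[of "cinner (T y) y"] bound[of y]
    by (simp add: T_def cinner_scaleC_left norm_mult c)
  define u v where "u = k *\<^sub>R x + T x" and "v = k *\<^sub>R x - T x"
  \<comment> \<open>Both are the factorisation of \<open>k^2 - T^2\<close> by the commuting
    \<open>k - T\<close> and \<open>k + T\<close>. With a common first argument, the two inner
    products merge into one against \<open>u + v\<close>.\<close>
  have "k *\<^sub>R u - T u = (k\<^sup>2) *\<^sub>R x - T (T x)" "k *\<^sub>R v + T v = (k\<^sup>2) *\<^sub>R x - T (T x)"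
    by (simp_all add: u_def v_def T_add T_diff T_scale algebra_simps power2_eq_square)
  moreover have "u + v = (2 * k) *\<^sub>R x"
    by (simp add: u_def v_def flip: scaleR_2)
  ultimately have "cinner (k *\<^sub>R u - T u) u + cinner (k *\<^sub>R v + T v) v
      = (2 * k) * cinner ((k\<^sup>2) *\<^sub>R x - T (T x)) x"
    by (metis cinner_add_right cinner_scaleR_right)
  also have "\<dots> = complex_of_real (2 * k * (k\<^sup>2 * (norm x)\<^sup>2 - cmod (cinner (A (A x)) x)))"
    by (simp add: cinner_diff_left cinner_scaleR_left TT cinner_scaleC_left d cinner_self)
  finally have "2 * k * (k\<^sup>2 * (norm x)\<^sup>2 - cmod (cinner (A (A x)) x))
      = Re (cinner (k *\<^sub>R u - T u) u + cinner (k *\<^sub>R v + T v) v)"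
    by (simp only: Re_complex_of_real)
  also have "\<dots> = k * (norm u)\<^sup>2 - Re (cinner (T u) u) + (k * (norm v)\<^sup>2 + Re (cinner (T v) v))"
    by (simp add: cinner_diff_left cinner_add_left cinner_scaleR_left cinner_self del: of_real_power)
  also have "\<dots> \<ge> 0"
    using T_bound[of u] T_bound[of v] by linarith
  finally show ?thesis using k by (simp add: zero_le_mult_iff)
qed

text \<open>Stated for an arbitrary bound \<open>K\<close> so that the Euclidean operator radius can
  be inserted directly.\<close>

lemma numerical_radius_square_le:
  fixes A :: "'a::complex_inner \<Rightarrow> 'a"
  assumes A: "bounded_clinear A" and K: "0 \<le> K"
    and bound: "\<And>x. norm x = 1 \<Longrightarrow> cmod (cinner (A x) x) \<le> K"
  shows "numerical_radius (A ^^ 2) \<le> K\<^sup>2"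
proof (rule numerical_radius_le)
  fix x :: 'a assume x: "norm x = 1"
  \<comment> \<open>The case \<open>K = 0\<close> is possible, whereas
    \<open>cinner_square_bound\<close> divides by its constant. Hence it is applied to
    \<open>K + e\<close>, and \<open>e\<close> then tends to 0 from the right.\<close>
  have le: "cmod (cinner (A (A x)) x) \<le> (K + e)\<^sup>2" if "0 < e" for e
  proof -
    have lin: "bounded_linear A" using A by (simp add: bounded_clinear_def)
    have "cmod (cinner (A z) z) \<le> K + e" if "norm z = 1" for z
      using bound[OF that] \<open>0 < e\<close> by linarith
    then have "cmod (cinner (A y) y) \<le> (K + e) * (norm y)\<^sup>2" for y
      by (rule cinner_bound_scale[OF lin])
    from cinner_square_bound[OF A _ this, of x] show ?thesis
      using K that x by simp
  qed
  have "((\<lambda>e. (K + e)\<^sup>2) \<longlongrightarrow> (K + 0)\<^sup>2) (at_right 0)"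
    by (intro tendsto_intros)
  moreover have "\<forall>\<^sub>F e in at_right 0. cmod (cinner (A (A x)) x) \<le> (K + e)\<^sup>2"
    by (rule eventually_mono[OF eventually_at_right_less le])
  ultimately have "cmod (cinner (A (A x)) x) \<le> (K + 0)\<^sup>2"
    by (intro tendsto_lowerbound) auto
  then show "cmod (cinner ((A ^^ 2) x) x) \<le> K\<^sup>2"
    by (simp add: numeral_2_eq_2)
qed simp

section \<open>The Euclidean operator radius and the final estimate\<close>

text \<open>The set is bounded above because the root of a sum of two squares is at most the sum of
  the two moduli, each of which is bounded on the unit sphere.\<close>

lemma euclidean_operator_radius_upper:
  fixes B C :: "'a::complex_inner \<Rightarrow> 'a"
  assumes "bounded_linear B" "bounded_linear C"
  shows "0 \<le> euclidean_operator_radius B C"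
    and "norm x = 1 \<Longrightarrow> sqrt ((cmod (cinner (B x) x))\<^sup>2 + (cmod (cinner (C x) x))\<^sup>2)
      \<le> euclidean_operator_radius B C"
proof -
  obtain K where K: "\<And>x. norm x = 1 \<Longrightarrow> cmod (cinner (B x) x) \<le> K"
    using bounded_linear_cinner_bound[OF assms(1)] by blast
  obtain L where L: "\<And>x. norm x = 1 \<Longrightarrow> cmod (cinner (C x) x) \<le> L"
    using bounded_linear_cinner_bound[OF assms(2)] by blast
  have "sqrt ((cmod (cinner (B x) x))\<^sup>2 + (cmod (cinner (C x) x))\<^sup>2) \<le> K + L" if "norm x = 1" for x
    using sqrt_sum_squares_le_sum[of "cmod (cinner (B x) x)" "cmod (cinner (C x) x)"]
      K[OF that] L[OF that] by simp
  then have "bdd_above (insert 0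
      {sqrt ((cmod (cinner (B x) x))\<^sup>2 + (cmod (cinner (C x) x))\<^sup>2) | x. norm x = 1})"
    unfolding bdd_above_insert by (auto intro!: bdd_aboveI)
  then show "0 \<le> euclidean_operator_radius B C"
    and "norm x = 1 \<Longrightarrow> sqrt ((cmod (cinner (B x) x))\<^sup>2 + (cmod (cinner (C x) x))\<^sup>2)
      \<le> euclidean_operator_radius B C"
    unfolding euclidean_operator_radius_def by (auto intro!: cSup_upper)
qed

text \<open>The first conjunct justifies reading the \<open>SUP\<close> as a maximum.\<close>

theorem theorem2p16:
  fixes B C :: "'a::chilbert_space \<Rightarrow> 'a"
  assumes "bounded_clinear B" and "bounded_clinear C"
  defines "f \<equiv> \<lambda>\<alpha>::real. numerical_radius (\<lambda>x. \<alpha> *\<^sub>R (B ^^ 2) x + (1 - \<alpha>) *\<^sub>R (C ^^ 2) x)"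
  shows "(\<exists>\<alpha>\<in>{0..1}. \<forall>\<beta>\<in>{0..1}. f \<beta> \<le> f \<alpha>) \<and>
    (SUP \<alpha>\<in>{0..1}. f \<alpha>) \<le> (euclidean_operator_radius B C)\<^sup>2"
proof -
  let ?w = "euclidean_operator_radius B C"
  have bl: "bounded_linear B" "bounded_linear C"
    using assms(1,2) by (auto simp: bounded_clinear_def)
  have bl2: "bounded_linear (B ^^ 2)" "bounded_linear (C ^^ 2)"
    using bounded_linear_compose[OF bl(1) bl(1)] bounded_linear_compose[OF bl(2) bl(2)]
    by (simp_all add: numeral_2_eq_2 o_def)
  have f1: "f 1 = numerical_radius (B ^^ 2)" and f0: "f 0 = numerical_radius (C ^^ 2)"
    by (simp_all add: f_def)
  \<comment> \<open>Convexity puts \<open>f \<beta>\<close> below the chord joining the endpoint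
    values, and so below the larger one. This yields both the maximiser and the bound on the
    supremum.\<close>
  have max: "f \<beta> \<le> max (f 0) (f 1)" if "\<beta> \<in> {0..1}" for \<beta>
  proof -
    have "f \<beta> \<le> \<beta> * f 1 + (1 - \<beta>) * f 0"
      unfolding f1 f0 using that bl2 by (subst f_def) (intro numerical_radius_convex, auto)
    also have "\<dots> \<le> max (f 0) (f 1)"
      using that by (intro convex_bound_le) auto
    finally show ?thesis .
  qed
  have "\<exists>\<alpha>\<in>{0..1}. \<forall>\<beta>\<in>{0..1}. f \<beta> \<le> f \<alpha>"
  proof (cases "f 0 \<le> f 1")
    case True
    then show ?thesis using max by (intro bexI[of _ 1]) auto
  next
    case False
    then show ?thesis using max by (intro bexI[of _ 0]) fastforce+
  qed
  moreover have "f 1 \<le> ?w\<^sup>2" "f 0 \<le> ?w\<^sup>2"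
  proof -
    \<comment> \<open>Dropping one of the two squares under the root compares each single modulus
      with \<open>?w\<close>.\<close>
    have "cmod (cinner (B x) x) \<le> ?w" "cmod (cinner (C x) x) \<le> ?w" if "norm x = 1" for x
      using euclidean_operator_radius_upper(2)[OF bl that]
        real_sqrt_sum_squares_ge1[of "cmod (cinner (B x) x)" "cmod (cinner (C x) x)"]
        real_sqrt_sum_squares_ge2[of "cmod (cinner (C x) x)" "cmod (cinner (B x) x)"]
      by linarith+
    then show "f 1 \<le> ?w\<^sup>2" "f 0 \<le> ?w\<^sup>2"
      unfolding f1 f0 using assms(1,2) euclidean_operator_radius_upper(1)[OF bl]
      by (auto intro: numerical_radius_square_le)
  qed
  ultimately show ?thesis
    using max by (intro conjI cSUP_least) (auto intro: order_trans[OF max])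
qed

end
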